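(* Let $\Sigma\subset[0,\infty)$ be an additive semigroup with $0\in\Sigma$, and suppose that $\mathbb{H}_+$ is dense in $M(AP_\Sigma)$. Let $f\in AP_\Sigma$ satisfy $$\inf_{z\in\mathbb{H}_+}|\hat f(z)|>0 .$$ Then there is $g\in AP_\Sigma$ such that $f=e^{g}$.
   Context: The algebra $AP$ of (uniformly) almost periodic functions is the smallest closed subalgebra of $L^\infty(\mathbb{R})$ (complex-valued, sup norm) containing all functions $e_\lambda(x):=e^{i\lambda x}$, $\lambda\in\mathbb{R}$. An almost periodic polynomial is a finite sum $\sum_j r_j e_{\lambda_j}$ with $r_j\in\mathbb{C}$, $\lambda_j\in\mathbb{R}$; the set of these is $AP^0$. The Bohr-Fourier spectrum of $a\in AP$ is $\Omega(a):=\{\lambda\in\mathbb{R} : \lim_{N\to\infty}\frac{1}{2N}\int_{-N}^{N}a(x)e_{-\lambda}(x)\,dx\neq 0\}$. A set $\Sigma\subset[0,\infty)$ is an additive semigroup if $\lambda,\mu\in\Sigma$ implies $\lambda+\mu\in\Sigma$. For such $\Sigma$ with $0\in\Sigma$, put $AP_\Sigma^0:=\{a\in AP^0 : \Omega(a)\subset\Sigma\}$ and let $AP_\Sigma$ be the closure of $AP_\Sigma^0$ in $AP$; it is a unital commutative Banach algebra (and equals $\{a\in AP:\Omega(a)\subset\Sigma\}$). $M(AP_\Sigma)$ denotes the set of nonzero algebra homomorphisms $AP_\Sigma\to\mathbb{C}$ equipped with the weak$^*$ (Gelfand) topology. $\mathbb{H}_+$ is the open upper half-plane in $\mathbb{C}$.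 Each $a\in AP_\Sigma$ extends by the Poisson integral formula to a holomorphic function $\hat a$ on $\mathbb{H}_+$, with $\sup_{\mathbb{H}_+}|\hat a|=\sup_{\mathbb{R}}|a|$. The map sending $z\in\mathbb{H}_+$ to the evaluation homomorphism $a\mapsto\hat a(z)$ maps $\mathbb{H}_+$ into $M(AP_\Sigma)$; "$\mathbb{H}_+$ is dense in $M(AP_\Sigma)$" means that the image of this map is dense in the Gelfand topology. *)

theory Defs
  imports "HOL-Analysis.Analysis"
begin

section \<open>Bounded continuous functions as a Banach algebra\<close>

lemma times_cont:
  fixes f g :: "'a::topological_space \<Rightarrow> 'b::real_normed_algebra"
  assumes "f \<in> bcontfun" "g \<in> bcontfun"
  shows "(\<lambda>x. f x * g x) \<in> bcontfun"
proof -
  obtain F where F: "\<And>x. norm (f x) \<le> F"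
    using assms(1) unfolding bcontfun_def bounded_iff by blast
  obtain G where G: "\<And>x. norm (g x) \<le> G"
    using assms(2) unfolding bcontfun_def bounded_iff by blast
  have "norm (f x * g x) \<le> F * G" for x
    using F[of x] G[of x]
    by (intro order_trans[OF norm_mult_ineq] mult_mono) (auto intro: order_trans[OF norm_ge_zero])
  then show ?thesis
    using assms by (intro bcontfun_normI[where b = "F * G"])
      (auto simp: bcontfun_def intro!: continuous_intros)
qed

instantiation bcontfun :: (topological_space, real_normed_algebra_1) real_normed_algebra_1
begin

definition times_bcontfun :: "('a \<Rightarrow>\<^sub>C 'b) \<Rightarrow> ('a \<Rightarrow>\<^sub>C 'b) \<Rightarrow> ('a \<Rightarrow>\<^sub>C 'b)"
  where "f * g = Bcontfun (\<lambda>x. apply_bcontfun f x * apply_bcontfun g x)"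

definition one_bcontfun :: "'a \<Rightarrow>\<^sub>C 'b"
  where "1 = const_bcontfun 1"

lemma apply_times_bcontfun [simp]:
  "apply_bcontfun (f * g) x = apply_bcontfun f x * apply_bcontfun g x"
  for f g :: "'a \<Rightarrow>\<^sub>C 'b"
  by (simp add: times_bcontfun_def Bcontfun_inverse times_cont apply_bcontfun)

lemma apply_one_bcontfun [simp]: "apply_bcontfun (1 :: 'a \<Rightarrow>\<^sub>C 'b) x = 1"
  by (simp add: one_bcontfun_def)

instance
proof
  show "norm (1 :: 'a \<Rightarrow>\<^sub>C 'b) = 1"
    using norm_bounded[of "1 :: 'a \<Rightarrow>\<^sub>C 'b" undefined]
    by (intro antisym norm_bound) simp_all
  show "(0 :: 'a \<Rightarrow>\<^sub>C 'b) \<noteq> 1"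
    by (metis apply_one_bcontfun zero_bcontfun.rep_eq zero_neq_one)
  show "norm (f * g) \<le> norm f * norm g" for f g :: "'a \<Rightarrow>\<^sub>C 'b"
    by (intro norm_bound)
      (auto intro!: order_trans[OF norm_mult_ineq] mult_mono norm_bounded)
qed (auto intro!: bcontfun_eqI simp: algebra_simps)

end

instance bcontfun :: (metric_space, banach) banach ..

lemma apply_exp_bcontfun: "apply_bcontfun (exp g) x = exp (apply_bcontfun g x)"
  for g :: "'a::metric_space \<Rightarrow>\<^sub>C 'b::{real_normed_algebra_1, banach}"
proof -
  have lin: "bounded_linear (\<lambda>f :: 'a \<Rightarrow>\<^sub>C 'b. apply_bcontfun f x)"
    by (rule bounded_linear_intro[where K = 1]) (auto simp: norm_bounded)
  have pow: "apply_bcontfun (g ^ n) x = apply_bcontfun g x ^ n" for n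
    by (induction n) auto
  have "apply_bcontfun (\<Sum>n. g ^ n /\<^sub>R fact n) x = (\<Sum>n. apply_bcontfun (g ^ n /\<^sub>R fact n) x)"
    by (rule bounded_linear.suminf[OF lin summable_exp_generic])
  then show ?thesis
    by (simp add: exp_def pow)
qed


section \<open>Almost periodic functions\<close>

text \<open>
  Elements of \<open>L\<^sup>\<infinity>(\<real>)\<close> that are almost periodic have a unique continuous representative, and on
  bounded continuous functions the essential supremum norm is the supremum norm. The Banach
  algebra of bounded continuous functions is therefore a closed subalgebra of \<open>L\<^sup>\<infinity>(\<real>)\<close>, and since
  it contains all \<open>ap_exp \<xi>\<close>, the smallest closed subalgebra containing them is the same in both.
\<close>

definition ap_exp :: "real \<Rightarrow> real \<Rightarrow>\<^sub>C complex"
  where "ap_exp \<xi> = Bcontfun (\<lambda>x. exp (\<i> * of_real \<xi> * of_real x))"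

lemma apply_ap_exp: "apply_bcontfun (ap_exp \<xi>) x = exp (\<i> * of_real \<xi> * of_real x)"
proof -
  have "(\<lambda>x. exp (\<i> * of_real \<xi> * of_real x)) \<in> bcontfun"
    by (rule bcontfun_normI[where b = 1]) (auto intro!: continuous_intros)
  then show ?thesis
    by (simp add: ap_exp_def Bcontfun_inverse)
qed

text \<open>Multiplication by the constant function \<open>const_bcontfun c\<close> is scalar multiplication by the
  complex number \<open>c\<close>, which the type class hierarchy does not provide.\<close>

definition subalgebra :: "(real \<Rightarrow>\<^sub>C complex) set \<Rightarrow> bool"
  where "subalgebra A \<longleftrightarrow> 0 \<in> A \<and>
    (\<forall>a\<in>A. \<forall>b\<in>A. a + b \<in> A \<and> a * b \<in> A) \<and> (\<forall>c. \<forall>a\<in>A. const_bcontfun c * a \<in> A)"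

definition AP :: "(real \<Rightarrow>\<^sub>C complex) set"
  where "AP = \<Inter>{A. subalgebra A \<and> closed A \<and> range ap_exp \<subseteq> A}"

definition AP0 :: "(real \<Rightarrow>\<^sub>C complex) set"
  where "AP0 = {\<Sum>j<n. const_bcontfun (r j) * ap_exp (l j) |(n::nat) r l. True}"

text \<open>The limit below exists for every \<open>a \<in> AP\<close>.\<close>

definition spectrum :: "(real \<Rightarrow>\<^sub>C complex) \<Rightarrow> real set"
  where "spectrum a = {\<xi>. \<exists>L. L \<noteq> 0 \<and>
    ((\<lambda>N. of_real (1 / (2 * N)) *
        integral {-N..N} (\<lambda>x. apply_bcontfun a x * apply_bcontfun (ap_exp (- \<xi>)) x)) \<longlongrightarrow> L) at_top}"

definition AP0_on :: "real set \<Rightarrow> (real \<Rightarrow>\<^sub>C complex) set"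
  where "AP0_on S = {a \<in> AP0. spectrum a \<subseteq> S}"

definition AP_on :: "real set \<Rightarrow> (real \<Rightarrow>\<^sub>C complex) set"
  where "AP_on S = AP \<inter> closure (AP0_on S)"


section \<open>Characters and the Gelfand topology\<close>

text \<open>Characters are maps defined on \<open>A\<close> only, so they are required to take the value \<open>undefined\<close>
  outside \<open>A\<close>; this makes the underlying total functions unique.\<close>

definition characters :: "(real \<Rightarrow>\<^sub>C complex) set \<Rightarrow> ((real \<Rightarrow>\<^sub>C complex) \<Rightarrow> complex) set"
  where "characters A = {\<phi> \<in> extensional A.
    (\<forall>a\<in>A. \<forall>b\<in>A. \<phi> (a + b) = \<phi> a + \<phi> b \<and> \<phi> (a * b) = \<phi> a * \<phi> b) \<and>
    (\<forall>c. \<forall>a\<in>A. \<phi> (const_bcontfun c * a) = c * \<phi> a) \<and>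
    (\<exists>a\<in>A. \<phi> a \<noteq> 0)}"

text \<open>The weak-* topology is the topology of pointwise convergence on \<open>A\<close>.\<close>

definition gelfand_topology ::
    "(real \<Rightarrow>\<^sub>C complex) set \<Rightarrow> ((real \<Rightarrow>\<^sub>C complex) \<Rightarrow> complex) topology"
  where "gelfand_topology A =
    subtopology (product_topology (\<lambda>_. euclidean) A) (characters A)"


section \<open>Extension to the upper half-plane\<close>

definition upper_half_plane :: "complex set"
  where "upper_half_plane = {z. 0 < Im z}"

definition poisson_ext :: "(real \<Rightarrow>\<^sub>C complex) \<Rightarrow> complex \<Rightarrow> complex"
  where "poisson_ext a z =
    (LBINT t. of_real (Im z / (pi * ((Re z - t)\<^sup>2 + (Im z)\<^sup>2))) * apply_bcontfun a t)"

definition evaluation :: "(real \<Rightarrow>\<^sub>C complex) set \<Rightarrow> complex \<Rightarrow> (real \<Rightarrow>\<^sub>C complex) \<Rightarrow> complex"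
  where "evaluation A z = (\<lambda>a\<in>A. poisson_ext a z)"

definition half_plane_dense :: "(real \<Rightarrow>\<^sub>C complex) set \<Rightarrow> bool"
  where "half_plane_dense A \<longleftrightarrow>
    gelfand_topology A closure_of (evaluation A ` upper_half_plane) = characters A"

end

theory Submission
  imports
    Defs
    "HOL-Complex_Analysis.Complex_Analysis"
    "HOL-Probability.Sinc_Integral"
    "HOL-Real_Asymp.Real_Asymp"
begin

text \<open>
  Let \<open>\<delta> > 0\<close> be a lower bound of \<open>\<bar>f\<bar>\<close> on the upper half-plane. The vertical translates
  \<open>x \<mapsto> f(x + it)\<close> form a path that starts at \<open>f\<close> for \<open>t = 0\<close> and, since all frequencies are nonnegative,
  tends uniformly to a constant, the zeroth Bohr-Fourier coefficient, as \<open>t \<rightarrow> \<infinity>\<close>. Along the whole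
  path the modulus stays at least \<open>\<delta>\<close>. The constant has modulus at least \<open>\<delta>\<close>, so it is an exponential,
  and the logarithm can be carried back along the path without leaving the algebra: if \<open>u = e\<^sup>g\<close>
  with \<open>\<bar>u\<bar> \<ge> \<delta>\<close> and \<open>\<parallel>v - u\<parallel> < \<delta>\<close>, then \<open>v = u (1 + h)\<close> with \<open>h = (v - u) e\<^sup>-\<^sup>g\<close> and
  \<open>\<parallel>h\<parallel> < 1\<close>, so that \<open>v\<close> is the exponential of \<open>g\<close> plus the power series of \<open>log (1 + h)\<close>
  (\<open>exp_image_perturb\<close>). The admissible step \<open>\<delta>\<close> is the same everywhere on the path, because the norm of
  the algebra is the supremum norm, which bounds the inverse of \<open>u\<close> by \<open>1 / \<delta>\<close>. So the points of the path
  that are exponentials form a set that is both open and closed (\<open>exp_image_connected\<close>).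

  The argument is carried out for a trigonometric polynomial \<open>p\<close> close to \<open>f\<close>, whose vertical
  translates are explicit (\<open>vertical_translate_in_exp_image\<close>). The lower bound passes from \<open>f\<close> to \<open>p\<close> because the
  Poisson extension is linear and does not increase the norm (\<open>norm_poisson_ext_le\<close>). That it
  extends \<open>e\<^sup>i\<^sup>\<lambda>\<^sup>x\<close> to \<open>e\<^sup>i\<^sup>\<lambda>\<^sup>z\<close> amounts to the
  Fourier transform of the Cauchy density (\<open>fourier_cauchy_density\<close>).
\<close>

section \<open>The Fourier transform of the Cauchy density\<close>

lemma cauchy_density_integral:
  shows integrable_cauchy_density: "integrable lborel (\<lambda>t::real. inverse (1 + t\<^sup>2))"
    and integral_cauchy_density: "(LBINT t::real. inverse (1 + t\<^sup>2)) = pi"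
  using integrable_inverse_1_plus_square LBINT_inverse_1_plus_square
  by (simp_all add: set_integrable_def interval_lebesgue_integral_def set_lebesgue_integral_def)

lemma integrable_cauchy_density_times:
  fixes b :: "real \<Rightarrow> complex"
  assumes "continuous_on UNIV b" "\<And>t. cmod (b t) \<le> B"
  shows "integrable lborel (\<lambda>t. of_real (inverse (1 + t\<^sup>2)) * b t)"
proof (rule Bochner_Integration.integrable_bound)
  show "integrable lborel (\<lambda>t::real. B * inverse (1 + t\<^sup>2))"
    by (intro integrable_mult_right integrable_cauchy_density)
  show "(\<lambda>t. of_real (inverse (1 + t\<^sup>2)) * b t) \<in> borel_measurable lborel"
    using borel_measurable_continuous_onI[OF assms(1)] by simp
  have "0 \<le> B"
    using norm_ge_zero assms(2) by (rule order_trans)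
  then show "AE t in lborel. norm (of_real (inverse (1 + t\<^sup>2)) * b t)
      \<le> norm (B * inverse (1 + t\<^sup>2))"
    using assms(2)
    by (intro AE_I2) (simp add: norm_mult mult.commute[of B] mult_left_mono del: of_real_inverse)
qed

text \<open>
  Subtracting the value \<open>e\<^sup>-\<^sup>l\<close> of \<open>e\<^sup>i\<^sup>l\<^sup>w\<close> at \<open>w = i\<close> removes the pole that \<open>1 / (1 + w\<^sup>2)\<close> has there, so
  Cauchy's theorem on the boundary of the upper half-disc of radius \<open>R\<close> needs no residue: the
  integral over the segment is minus that over the arc, on which \<open>\<bar>e\<^sup>i\<^sup>l\<^sup>w\<bar> \<le> 1\<close> and
  \<open>\<bar>1 + w\<^sup>2\<bar> \<ge> R\<^sup>2 - 1\<close>.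
\<close>
lemma fourier_cauchy_density_truncated:
  assumes "0 \<le> l" "1 < R"
  shows "cmod (integral {-R..R} (\<lambda>t. of_real (inverse (1 + t\<^sup>2)) *
      (exp (\<i> * of_real l * of_real t) - of_real (exp (- l))))) \<le> 2 / (R\<^sup>2 - 1) * R * pi"
proof -
  define F where "F w = exp (\<i> * of_real l * w)" for w :: complex
  define q where "q w = (if w = \<i> then deriv F \<i> else (F w - F \<i>) / (w - \<i>)) / (w + \<i>)" for w
  \<comment> \<open>A convex region that contains the closed half-disc but not the other pole \<open>-i\<close>.\<close>
  define S where "S = {w::complex. Im w > -1}"
  have "\<i> * of_real l * \<i> = - of_real l"
    by (simp add: complex_eq_iff)
  then have F_i: "F \<i> = of_real (exp (- l))"
    by (simp add: F_def flip: exp_of_real)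
  have "F holomorphic_on UNIV"
    unfolding F_def by (intro holomorphic_intros)
  then have "(\<lambda>w. if w = \<i> then deriv F \<i> else (F w - F \<i>) / (w - \<i>)) holomorphic_on UNIV"
    by (rule pole_lemma_open) simp
  then have "(\<lambda>w. if w = \<i> then deriv F \<i> else (F w - F \<i>) / (w - \<i>)) holomorphic_on S"
    by (rule holomorphic_on_subset) simp
  moreover have "w + \<i> \<noteq> 0" if "w \<in> S" for w
    using that by (auto simp: S_def complex_eq_iff)
  ultimately have holo: "q holomorphic_on S"
    unfolding q_def by (intro holomorphic_intros) auto
  have q_eq: "q w = (F w - of_real (exp (- l))) / (1 + w\<^sup>2)" if "w \<noteq> \<i>" for w
  proof -
    have "(w - \<i>) * (w + \<i>) = 1 + w\<^sup>2"
      by (simp add: algebra_simps power2_eq_square)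
    then show ?thesis
      using that by (simp add: q_def F_i)
  qed
  define g where "g = linepath (of_real (- R)) (of_real R) +++ part_circlepath 0 R 0 pi"
  have ends: "pathstart (part_circlepath 0 R 0 pi) = of_real R"
      "pathfinish (part_circlepath 0 R 0 pi) = of_real (- R)"
    by (simp_all add: exp_Euler)
  have arc: "cmod w = R \<and> 0 \<le> Im w" if w: "w \<in> path_image (part_circlepath 0 R 0 pi)" for w
  proof -
    obtain t where t: "0 \<le> t" "t \<le> pi" "w = of_real R * cis t"
      using w assms by (auto simp: path_image_part_circlepath cis_conv_exp)
    then show ?thesis
      using assms sin_ge_zero[of t] by (auto simp: norm_mult)
  qed
  have line: "Im w = 0" if "w \<in> closed_segment (of_real (- R)) (of_real R)" for w
    using that by (auto simp: closed_segment_def)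
  have "(q has_contour_integral 0) g"
  proof (rule Cauchy_theorem_convex_simple[OF holo])
    show "convex S"
      unfolding S_def using convex_halfspace_Im_gt .
    show "valid_path g" "pathfinish g = pathstart g"
      unfolding g_def using ends by (auto intro!: valid_path_join)
    show "path_image g \<subseteq> S"
      using arc line ends by (fastforce simp: g_def path_image_join S_def)
  qed
  moreover have "q contour_integrable_on linepath (of_real (- R)) (of_real R)"
    using line by (intro contour_integrable_continuous_linepath continuous_on_subset[OF
          holomorphic_on_imp_continuous_on[OF holo]]) (fastforce simp: S_def)
  moreover have arc_int: "q contour_integrable_on part_circlepath 0 R 0 pi"
    using arc by (intro contour_integrable_continuous_part_circlepath continuous_on_subset[OF
          holomorphic_on_imp_continuous_on[OF holo]]) (fastforce simp: S_def)
  ultimately have sum0: "contour_integral (linepath (of_real (- R)) (of_real R)) q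
      + contour_integral (part_circlepath 0 R 0 pi) q = 0"
    using ends by (metis g_def contour_integral_join contour_integral_unique
        valid_path_linepath valid_path_part_circlepath)
  have "cmod (contour_integral (part_circlepath 0 R 0 pi) q) \<le> 2 / (R\<^sup>2 - 1) * R * (pi - 0)"
  proof (rule has_contour_integral_bound_part_circlepath[OF has_contour_integral_integral[OF arc_int]])
    have R1: "1 < R\<^sup>2"
      using assms by (simp add: one_less_power)
    then show "0 \<le> 2 / (R\<^sup>2 - 1)"
      by simp
    fix w assume "w \<in> path_image (part_circlepath 0 R 0 pi)"
    with arc have w: "cmod w = R" "0 \<le> Im w"
      by auto
    have "cmod (F w) \<le> 1"
      using assms w by (simp add: F_def)
    moreover have "exp (- l) \<le> 1"
      using assms by simp
    ultimately have "cmod (F w - of_real (exp (- l))) \<le> 2"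
      using norm_triangle_ineq4[of "F w" "of_real (exp (- l))"] by (simp del: exp_le_one_iff)
    moreover have "R\<^sup>2 - 1 \<le> cmod (1 + w\<^sup>2)"
      using norm_triangle_ineq4[of "1 + w\<^sup>2" 1] w by (simp add: norm_power)
    moreover have "w \<noteq> \<i>"
      using w assms by auto
    ultimately show "cmod (q w) \<le> 2 / (R\<^sup>2 - 1)"
      using R1 by (simp add: q_eq norm_divide frac_le)
  qed (use assms in auto)
  moreover have "contour_integral (linepath (of_real (- R)) (of_real R)) q
      = integral {-R..R} (\<lambda>t. q (of_real t))"
    using assms by (subst contour_integral_linepath_Reals_eq) auto
  moreover have "q (of_real t) = of_real (inverse (1 + t\<^sup>2)) *
      (exp (\<i> * of_real l * of_real t) - of_real (exp (- l)))" for t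
    by (subst q_eq) (auto simp: F_def complex_eq_iff[of _ \<i>] field_simps)
  ultimately show ?thesis
    using sum0 by (simp add: add_eq_0_iff norm_minus_commute)
qed

text \<open>The bound for the truncated integral tends to \<open>0\<close>, so the Cauchy density does not distinguish
  \<open>e\<^sup>i\<^sup>l\<^sup>t\<close> from the constant \<open>e\<^sup>-\<^sup>l\<close>, whose integral is \<open>\<pi> e\<^sup>-\<^sup>l\<close>.\<close>
lemma fourier_cauchy_density:
  assumes "0 \<le> l"
  shows "(LBINT t. of_real (inverse (1 + t\<^sup>2)) * exp (\<i> * of_real l * of_real t))
    = of_real (pi * exp (- l))"
proof -
  define E where "E t = exp (\<i> * of_real l * of_real t)" for t :: real
  define D where "D t = of_real (inverse (1 + t\<^sup>2)) * (E t - of_real (exp (- l)))" for t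
  have E: "continuous_on UNIV E" "\<And>t. cmod (E t) \<le> 1"
    unfolding E_def by (auto intro!: continuous_intros)
  have intE: "integrable lborel (\<lambda>t. of_real (inverse (1 + t\<^sup>2)) * E t)"
    using integrable_cauchy_density_times[OF E] .
  have intC: "integrable lborel (\<lambda>t. of_real (inverse (1 + t\<^sup>2)) * complex_of_real (exp (- l)))"
    by (rule integrable_cauchy_density_times[OF _ order_refl]) simp
  have D_eq: "D = (\<lambda>t. of_real (inverse (1 + t\<^sup>2)) * E t
      - of_real (inverse (1 + t\<^sup>2)) * of_real (exp (- l)))"
    by (simp add: D_def right_diff_distrib fun_eq_iff)
  have intD: "integrable lborel D"
    unfolding D_eq using intE intC by (rule Bochner_Integration.integrable_diff)
  have setD: "set_integrable lborel X D" if "X \<in> sets borel" for X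
    unfolding set_integrable_def using intD that by (intro integrable_mult_indicator) auto
  have UN: "(\<Union>n::nat. {- real n..real n}) = UNIV"
  proof (intro equalityI subsetI UNIV_I)
    fix x :: real
    obtain n :: nat where "\<bar>x\<bar> \<le> real n"
      using real_arch_simple by blast
    then show "x \<in> (\<Union>n::nat. {- real n..real n})"
      by (auto simp: abs_le_iff intro!: exI[of _ n])
  qed
  have "(\<lambda>n. LBINT t:{- real n..real n}. D t) \<longlonglongrightarrow> (LBINT t:(\<Union>n::nat. {- real n..real n}). D t)"
    by (rule set_integral_cont_up) (auto simp: incseq_def intro!: setD borel_open simp: UN)
  then have lim: "(\<lambda>n. LBINT t:{- real n..real n}. D t) \<longlonglongrightarrow> (LBINT t. D t)"
    by (simp add: UN set_lebesgue_integral_def)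
  moreover have "(\<lambda>n. LBINT t:{- real n..real n}. D t) \<longlonglongrightarrow> 0"
  proof (rule Lim_null_comparison)
    show "(\<lambda>n. 2 / ((real n)\<^sup>2 - 1) * real n * pi) \<longlonglongrightarrow> 0"
      by real_asymp
    have "norm (LBINT t:{- real n..real n}. D t) \<le> 2 / ((real n)\<^sup>2 - 1) * real n * pi"
      if "2 \<le> n" for n
      using fourier_cauchy_density_truncated[OF assms, of "real n"] that
        set_borel_integral_eq_integral(2)[OF setD, of "{- real n..real n}"]
      by (simp add: D_def[abs_def] E_def)
    then show "\<forall>\<^sub>F n in sequentially. norm (LBINT t:{- real n..real n}. D t)
        \<le> 2 / ((real n)\<^sup>2 - 1) * real n * pi"
      by (auto simp: eventually_sequentially)
  qed
  ultimately have "(LBINT t. D t) = 0"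
    using LIMSEQ_unique by blast
  moreover have "(LBINT t. D t) = (LBINT t. of_real (inverse (1 + t\<^sup>2)) * E t)
      - (LBINT t. of_real (inverse (1 + t\<^sup>2)) * complex_of_real (exp (- l)))"
    unfolding D_eq using intE intC by (rule Bochner_Integration.integral_diff)
  moreover have "(LBINT t::real. of_real (inverse (1 + t\<^sup>2)) * complex_of_real (exp (- l)))
      = of_real (pi * exp (- l))"
    using integral_cauchy_density
    by (simp flip: of_real_mult del: of_real_inverse of_real_mult)
  ultimately show ?thesis
    by (simp add: E_def)
qed

section \<open>The Poisson extension\<close>

text \<open>The substitution of \<open>Re z + Im z * t\<close> for the integration variable turns the Poisson kernel at
  every \<open>z\<close> into the Cauchy density.\<close>
lemma poisson_ext_eq:
  assumes "0 < Im z"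
  shows "poisson_ext a z =
    (LBINT t. of_real (inverse (1 + t\<^sup>2)) * apply_bcontfun a (Re z + Im z * t)) / of_real pi"
proof -
  have "Im z / (pi * ((Re z - (Re z + Im z * t))\<^sup>2 + (Im z)\<^sup>2))
      = inverse (1 + t\<^sup>2) / (pi * Im z)" for t
  proof -
    have "(Re z - (Re z + Im z * t))\<^sup>2 + (Im z)\<^sup>2 = (Im z)\<^sup>2 * (1 + t\<^sup>2)"
      by (simp add: power2_eq_square algebra_simps)
    moreover have "Im z / (pi * ((Im z)\<^sup>2 * u)) = inverse u / (pi * Im z)" if "u > 0" for u
      using assms that by (simp add: power2_eq_square field_simps)
    ultimately show ?thesis
      by (simp add: add_pos_nonneg)
  qed
  note kernel = this
  have affine: "(LBINT t. h t) = Im z *\<^sub>R (LBINT t. h (Re z + Im z * t))" for h :: "real \<Rightarrow> complex"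
    using lborel_integral_real_affine[of "Im z" h "Re z"] assms by simp
  have "poisson_ext a z = Im z *\<^sub>R
      (LBINT t. of_real (Im z / (pi * ((Re z - (Re z + Im z * t))\<^sup>2 + (Im z)\<^sup>2)))
        * apply_bcontfun a (Re z + Im z * t))"
    unfolding poisson_ext_def by (rule affine)
  also have "(\<lambda>t. of_real (Im z / (pi * ((Re z - (Re z + Im z * t))\<^sup>2 + (Im z)\<^sup>2)))
        * apply_bcontfun a (Re z + Im z * t)) =
      (\<lambda>t. of_real (inverse (1 + t\<^sup>2)) * apply_bcontfun a (Re z + Im z * t) / of_real (pi * Im z))"
    by (simp only: kernel of_real_divide times_divide_eq_left)
  also have "(LBINT t. \<dots> t) = (LBINT t. of_real (inverse (1 + t\<^sup>2))
      * apply_bcontfun a (Re z + Im z * t)) / of_real (pi * Im z)"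
    by (rule integral_divide_zero)
  finally show ?thesis
    using assms by (simp add: scaleR_conv_of_real)
qed

lemma integrable_poisson:
  "integrable lborel (\<lambda>t. of_real (inverse (1 + t\<^sup>2)) * apply_bcontfun a (x + y * t :: real) :: complex)"
proof (rule integrable_cauchy_density_times)
  show "continuous_on UNIV (\<lambda>t. apply_bcontfun a (x + y * t))"
    by (rule continuous_on_compose2[of UNIV "apply_bcontfun a"]) (auto intro!: continuous_intros)
  show "cmod (apply_bcontfun a (x + y * t)) \<le> norm a" for t
    by (rule norm_bounded)
qed

lemma poisson_ext_diff:
  assumes "0 < Im z"
  shows "poisson_ext (a - b) z = poisson_ext a z - poisson_ext b z"
  using assms integrable_poisson
  by (simp add: poisson_ext_eq right_diff_distrib diff_divide_distrib del: of_real_inverse)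

lemma poisson_ext_sum:
  assumes "0 < Im z"
  shows "poisson_ext (\<Sum>i\<in>I. a i) z = (\<Sum>i\<in>I. poisson_ext (a i) z)"
proof (induction I rule: infinite_finite_induct)
  case (insert i I)
  have "poisson_ext (a i + (\<Sum>i\<in>I. a i)) z = poisson_ext (a i) z + poisson_ext (\<Sum>i\<in>I. a i) z"
    using assms integrable_poisson
    by (simp add: poisson_ext_eq distrib_left add_divide_distrib del: of_real_inverse)
  with insert show ?case
    by simp
qed (simp_all add: poisson_ext_def)

text \<open>The Poisson kernel is positive and has integral \<open>1\<close>.\<close>
lemma norm_poisson_ext_le:
  assumes "0 < Im z"
  shows "cmod (poisson_ext a z) \<le> norm a"
proof -
  have "norm (LBINT t. of_real (inverse (1 + t\<^sup>2)) * apply_bcontfun a (Re z + Im z * t))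
      \<le> (LBINT t. norm a * inverse (1 + t\<^sup>2))"
  proof (rule Bochner_Integration.integral_norm_bound_integral)
    show "integrable lborel (\<lambda>t::real. norm a * inverse (1 + t\<^sup>2))"
      by (intro integrable_mult_right integrable_cauchy_density)
    show "norm (of_real (inverse (1 + t\<^sup>2)) * apply_bcontfun a (Re z + Im z * t))
        \<le> norm a * inverse (1 + t\<^sup>2)" for t
      using norm_bounded[of a]
      by (simp add: norm_mult mult.commute[of "norm a"] mult_left_mono del: of_real_inverse)
  qed (rule integrable_poisson)
  also have "\<dots> = norm a * pi"
    by (simp only: integral_mult_right_zero integral_cauchy_density)
  finally show ?thesis
    using assms by (simp add: poisson_ext_eq norm_divide pos_divide_le_eq del: of_real_inverse)
qed

lemma poisson_ext_ap_exp:
  assumes "0 \<le> l" "0 < Im z"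
  shows "poisson_ext (const_bcontfun c * ap_exp l) z
    = c * exp (\<i> * of_real l * z)"
proof -
  have "of_real (inverse (1 + t\<^sup>2)) * apply_bcontfun (const_bcontfun c * ap_exp l) (Re z + Im z * t)
      = c * exp (\<i> * of_real l * of_real (Re z)) *
        (of_real (inverse (1 + t\<^sup>2)) * exp (\<i> * of_real (l * Im z) * of_real t))" for t :: real
    by (simp add: apply_ap_exp exp_add algebra_simps)
  then have "poisson_ext (const_bcontfun c * ap_exp l) z
      = c * exp (\<i> * of_real l * of_real (Re z)) *
        (LBINT t. of_real (inverse (1 + t\<^sup>2)) * exp (\<i> * of_real (l * Im z) * of_real t)) / of_real pi"
    using assms by (simp only: poisson_ext_eq integral_mult_right_zero)
  also have "\<dots> = c * (exp (\<i> * of_real l * of_real (Re z)) * of_real (exp (- (l * Im z))))"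
    using assms by (subst fourier_cauchy_density) auto
  also have "exp (\<i> * of_real l * of_real (Re z)) * of_real (exp (- (l * Im z)))
      = exp (\<i> * of_real l * z)"
  proof -
    have "\<i> * of_real l * of_real (Re z) + of_real (- (l * Im z)) = \<i> * of_real l * z"
      by (simp add: complex_eq_iff)
    then show ?thesis
      by (simp only: exp_of_real[symmetric] exp_add[symmetric])
  qed
  finally show ?thesis .
qed

section \<open>Trigonometric polynomials and their spectrum\<close>

lemma ap_exp_zero: "ap_exp 0 = 1"
  by (rule bcontfun_eqI) (simp add: apply_ap_exp)

lemma ap_exp_add: "ap_exp (l + m) = ap_exp l * ap_exp m"
  by (rule bcontfun_eqI) (simp add: apply_ap_exp algebra_simps exp_add)

lemma apply_sum_bcontfun: "apply_bcontfun (\<Sum>i\<in>I. f i) x = (\<Sum>i\<in>I. apply_bcontfun (f i) x)"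
  by (induction I rule: infinite_finite_induct) auto

lemma const_bcontfun_of_real: "const_bcontfun (complex_of_real r) * a = r *\<^sub>R a"
  for a :: "real \<Rightarrow>\<^sub>C complex"
  by (rule bcontfun_eqI) (simp add: of_real_def)

text \<open>Indexing by a set of frequencies, instead of a list that may repeat them, makes the coefficients
  those of the Bohr-Fourier expansion, so that the spectrum can be read off.\<close>
definition trig_polys :: "real set \<Rightarrow> (real \<Rightarrow>\<^sub>C complex) set"
  where "trig_polys S = {\<Sum>l\<in>F. const_bcontfun (c l) * ap_exp l |F c. finite F \<and> F \<subseteq> S}"

lemma trig_polys_term: "l \<in> S \<Longrightarrow> const_bcontfun c * ap_exp l \<in> trig_polys S"
  unfolding trig_polys_def
  by (auto intro!: exI[of _ "{l}"] exI[of _ "\<lambda>_. c"])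

lemma trig_polys_add:
  assumes "a \<in> trig_polys S" "b \<in> trig_polys S"
  shows "a + b \<in> trig_polys S"
proof -
  obtain F c where F: "finite F" "F \<subseteq> S" "a = (\<Sum>l\<in>F. const_bcontfun (c l) * ap_exp l)"
    using assms(1) by (auto simp: trig_polys_def)
  obtain G d where G: "finite G" "G \<subseteq> S" "b = (\<Sum>l\<in>G. const_bcontfun (d l) * ap_exp l)"
    using assms(2) by (auto simp: trig_polys_def)
  have c0: "const_bcontfun (0 :: complex) * u = 0" for u :: "real \<Rightarrow>\<^sub>C complex"
    by (rule bcontfun_eqI) simp
  \<comment> \<open>Zero coefficients bring both sums to the common set of frequencies \<open>F \<union> G\<close>.\<close>
  have "a = (\<Sum>l\<in>F \<union> G. const_bcontfun (if l \<in> F then c l else 0) * ap_exp l)"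
    unfolding F(3) by (rule sum.mono_neutral_cong_left) (use F G c0 in auto)
  moreover have "b = (\<Sum>l\<in>F \<union> G. const_bcontfun (if l \<in> G then d l else 0) * ap_exp l)"
    unfolding G(3) by (rule sum.mono_neutral_cong_left) (use F G c0 in auto)
  moreover have "const_bcontfun u * e + const_bcontfun v * e = const_bcontfun (u + v) * e"
    for u v :: complex and e :: "real \<Rightarrow>\<^sub>C complex"
    by (rule bcontfun_eqI) (simp add: distrib_right)
  ultimately have "a + b = (\<Sum>l\<in>F \<union> G.
      const_bcontfun ((if l \<in> F then c l else 0) + (if l \<in> G then d l else 0)) * ap_exp l)"
    by (simp only: sum.distrib[symmetric])
  then show ?thesis
    unfolding trig_polys_def using F(1,2) G(1,2) by (auto intro!: exI[of _ "F \<union> G"])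
qed

lemma trig_polys_zero: "0 \<in> trig_polys S"
  unfolding trig_polys_def by (auto intro!: exI[of _ "{}"])

lemma trig_polys_sum: "(\<And>i. i \<in> I \<Longrightarrow> a i \<in> trig_polys S) \<Longrightarrow> (\<Sum>i\<in>I. a i) \<in> trig_polys S"
  by (induction I rule: infinite_finite_induct) (auto intro: trig_polys_zero trig_polys_add)

lemma AP0_eq_trig_polys: "AP0 = trig_polys UNIV"
proof
  show "AP0 \<subseteq> trig_polys UNIV"
    unfolding AP0_def by (auto intro!: trig_polys_sum trig_polys_term)
  show "trig_polys UNIV \<subseteq> AP0"
  proof
    fix a assume "a \<in> trig_polys UNIV"
    then obtain F c where F: "finite F" "a = (\<Sum>l\<in>F. const_bcontfun (c l) * ap_exp l)"
      by (auto simp: trig_polys_def)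
    obtain h where h: "bij_betw h {0..<card F} F"
      using ex_bij_betw_nat_finite[OF F(1)] by blast
    then have "a = (\<Sum>j<card F. const_bcontfun (c (h j)) * ap_exp (h j))"
      unfolding F(2) lessThan_atLeast0 by (rule sum.reindex_bij_betw[symmetric])
    then show "a \<in> AP0"
      unfolding AP0_def by (auto intro!: exI[of _ "\<lambda>j. c (h j)"] exI[of _ h])
  qed
qed

text \<open>For \<open>m \<noteq> 0\<close> the primitive \<open>e\<^sup>i\<^sup>m\<^sup>x / (i m)\<close> is bounded, so the integrals over \<open>[-N, N]\<close> are
  bounded and the means tend to \<open>0\<close>.\<close>
lemma mean_ap_exp:
  "((\<lambda>N. of_real (1 / (2 * N)) * integral {-N..N} (apply_bcontfun (ap_exp m)))
    \<longlongrightarrow> (if m = 0 then 1 else 0)) at_top"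
proof (cases "m = 0")
  case True
  have "\<forall>\<^sub>F N::real in at_top. of_real (1 / (2 * N)) * integral {-N..N} (apply_bcontfun (ap_exp m))
      = (1::complex)"
    using eventually_gt_at_top[of 0]
    by eventually_elim (simp add: True apply_ap_exp[abs_def] scaleR_conv_of_real)
  then show ?thesis
    using True by (simp add: tendsto_eventually)
next
  case False
  have bound: "norm (of_real (1 / (2 * N)) * integral {-N..N} (apply_bcontfun (ap_exp m)))
      \<le> 1 / \<bar>m\<bar> / N"
    if "N > 0" for N
  proof -
    define G where "G x = exp (\<i> * of_real m * of_real x) / (\<i> * of_real m)" for x :: real
    have "(G has_vector_derivative apply_bcontfun (ap_exp m) x) (at x within {-N..N})" for x
      unfolding G_def apply_ap_exp using False
      by (auto intro!: derivative_eq_intros has_vector_derivative_real_field)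
    then have "(apply_bcontfun (ap_exp m) has_integral G N - G (- N)) {-N..N}"
      using that by (intro fundamental_theorem_of_calculus) auto
    moreover have "cmod (G x) = 1 / \<bar>m\<bar>" for x
      by (simp add: G_def norm_divide norm_mult)
    ultimately have "norm (integral {-N..N} (apply_bcontfun (ap_exp m))) \<le> 2 / \<bar>m\<bar>"
      using norm_triangle_ineq4[of "G N" "G (- N)"] by (simp add: integral_unique)
    then show ?thesis
      using that by (simp add: norm_mult norm_divide field_simps)
  qed
  have "((\<lambda>N. 1 / \<bar>m\<bar> / N) \<longlongrightarrow> 0) at_top"
    using False by real_asymp
  moreover have "\<forall>\<^sub>F N in at_top. norm (of_real (1 / (2 * N))
      * integral {-N..N} (apply_bcontfun (ap_exp m))) \<le> 1 / \<bar>m\<bar> / N"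
    using eventually_gt_at_top[of "0::real"] by eventually_elim (rule bound)
  ultimately have "((\<lambda>N. of_real (1 / (2 * N)) * integral {-N..N} (apply_bcontfun (ap_exp m)))
      \<longlongrightarrow> 0) at_top"
    by (rule Lim_null_comparison[rotated])
  then show ?thesis
    using False by simp
qed

lemma bohr_coefficient_trig_poly:
  assumes "finite F"
  shows "((\<lambda>N. of_real (1 / (2 * N)) * integral {-N..N} (\<lambda>x.
      apply_bcontfun (\<Sum>l\<in>F. const_bcontfun (c l) * ap_exp l) x * apply_bcontfun (ap_exp (- \<xi>)) x))
    \<longlongrightarrow> (if \<xi> \<in> F then c \<xi> else 0)) at_top"
proof -
  have "integral {-N..N} (\<lambda>x. apply_bcontfun (\<Sum>l\<in>F. const_bcontfun (c l) * ap_exp l) x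
        * apply_bcontfun (ap_exp (- \<xi>)) x)
      = (\<Sum>l\<in>F. c l * integral {-N..N} (apply_bcontfun (ap_exp (l - \<xi>))))" for N
  proof -
    have "(\<lambda>x. apply_bcontfun (\<Sum>l\<in>F. const_bcontfun (c l) * ap_exp l) x
        * apply_bcontfun (ap_exp (- \<xi>)) x)
      = (\<lambda>x. \<Sum>l\<in>F. c l * apply_bcontfun (ap_exp (l - \<xi>)) x)"
      by (simp add: apply_sum_bcontfun sum_distrib_right ap_exp_add[of _ "- \<xi>", simplified] mult.assoc)
    moreover have "(\<lambda>x. apply_bcontfun (ap_exp (l - \<xi>)) x) integrable_on {-N..N}" for l
      by (intro integrable_continuous_real) auto
    ultimately show ?thesis
      using assms by (simp add: Henstock_Kurzweil_Integration.integral_sum integrable_on_mult_right)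
  qed
  then have "(\<lambda>N. of_real (1 / (2 * N)) * integral {-N..N} (\<lambda>x.
        apply_bcontfun (\<Sum>l\<in>F. const_bcontfun (c l) * ap_exp l) x * apply_bcontfun (ap_exp (- \<xi>)) x))
      = (\<lambda>N. \<Sum>l\<in>F. c l * (of_real (1 / (2 * N)) * integral {-N..N} (apply_bcontfun (ap_exp (l - \<xi>)))))"
    by (simp add: sum_distrib_left ac_simps)
  moreover have "((\<lambda>N. \<Sum>l\<in>F. c l * (of_real (1 / (2 * N)) * integral {-N..N} (apply_bcontfun (ap_exp (l - \<xi>)))))
      \<longlongrightarrow> (\<Sum>l\<in>F. c l * (if l - \<xi> = 0 then 1 else 0))) at_top"
    by (intro tendsto_sum tendsto_mult_left mean_ap_exp)
  moreover have "(\<Sum>l\<in>F. c l * (if l - \<xi> = 0 then 1 else 0)) = (if \<xi> \<in> F then c \<xi> else 0)"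
    using assms by (simp add: if_distrib[of "\<lambda>u. _ * u"] cong: if_cong)
  ultimately show ?thesis
    by simp
qed

lemma spectrum_trig_poly:
  assumes "finite F"
  shows "spectrum (\<Sum>l\<in>F. const_bcontfun (c l) * ap_exp l) = {l \<in> F. c l \<noteq> 0}"
proof -
  have "(\<exists>L. L \<noteq> 0 \<and> ((\<lambda>N. of_real (1 / (2 * N)) * integral {-N..N} (\<lambda>x.
      apply_bcontfun (\<Sum>l\<in>F. const_bcontfun (c l) * ap_exp l) x * apply_bcontfun (ap_exp (- \<xi>)) x))
      \<longlongrightarrow> L) at_top) \<longleftrightarrow> (if \<xi> \<in> F then c \<xi> else 0) \<noteq> 0" for \<xi>
    using bohr_coefficient_trig_poly[OF assms, of c \<xi>]
      tendsto_unique[OF trivial_limit_at_top_linorder _ bohr_coefficient_trig_poly[OF assms, of c \<xi>]]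
    by blast
  then show ?thesis
    by (auto simp only: spectrum_def mem_Collect_eq split: if_splits)
qed

text \<open>A representation of an element of \<open>AP0_on S\<close> may mention frequencies outside \<open>S\<close>, but only
  with total coefficient \<open>0\<close>, since the spectrum consists of the frequencies whose coefficient is not \<open>0\<close>.\<close>
lemma AP0_on_eq_trig_polys: "AP0_on S = trig_polys S"
proof
  show "trig_polys S \<subseteq> AP0_on S"
    unfolding AP0_on_def AP0_eq_trig_polys using spectrum_trig_poly by (fastforce simp: trig_polys_def)
  show "AP0_on S \<subseteq> trig_polys S"
  proof
    fix a assume "a \<in> AP0_on S"
    then obtain F c where F: "finite F" "a = (\<Sum>l\<in>F. const_bcontfun (c l) * ap_exp l)"
        and "spectrum a \<subseteq> S"
      unfolding AP0_on_def AP0_eq_trig_polys by (auto simp: trig_polys_def)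
    then have "{l \<in> F. c l \<noteq> 0} \<subseteq> S"
      by (simp add: spectrum_trig_poly)
    moreover have "a = (\<Sum>l\<in>{l \<in> F. c l \<noteq> 0}. const_bcontfun (c l) * ap_exp l)"
      unfolding F(2) using F(1) by (intro sum.mono_neutral_right) (auto intro!: bcontfun_eqI)
    ultimately show "a \<in> trig_polys S"
      unfolding trig_polys_def using F(1) by (intro CollectI exI[of _ "{l \<in> F. c l \<noteq> 0}"] exI[of _ c]) simp
  qed
qed

section \<open>The algebra \<open>AP_on S\<close>\<close>

lemma subalgebra_trig_polys:
  assumes "\<And>l m. l \<in> S \<Longrightarrow> m \<in> S \<Longrightarrow> l + m \<in> S"
  shows "subalgebra (trig_polys S)"
proof -
  have mult: "a * b \<in> trig_polys S" if a: "a \<in> trig_polys S" and b: "b \<in> trig_polys S" for a b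
  proof -
    obtain F c where F: "F \<subseteq> S" "a = (\<Sum>l\<in>F. const_bcontfun (c l) * ap_exp l)"
      using a by (auto simp: trig_polys_def)
    obtain G d where G: "G \<subseteq> S" "b = (\<Sum>l\<in>G. const_bcontfun (d l) * ap_exp l)"
      using b by (auto simp: trig_polys_def)
    have "(const_bcontfun (c l) * ap_exp l) * (const_bcontfun (d m) * ap_exp m)
        = const_bcontfun (c l * d m) * ap_exp (l + m)" for l m
      by (rule bcontfun_eqI) (simp add: ap_exp_add)
    then have "a * b = (\<Sum>l\<in>F. \<Sum>m\<in>G. const_bcontfun (c l * d m) * ap_exp (l + m))"
      unfolding F(2) G(2) by (simp add: sum_product)
    then show ?thesis
      using F(1) G(1) by (auto intro!: trig_polys_sum trig_polys_term assms)
  qed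
  have "const_bcontfun c * a \<in> trig_polys S" if a: "a \<in> trig_polys S" for c a
  proof -
    obtain F d where F: "F \<subseteq> S" "a = (\<Sum>l\<in>F. const_bcontfun (d l) * ap_exp l)"
      using a by (auto simp: trig_polys_def)
    have "const_bcontfun c * (const_bcontfun (d l) * ap_exp l) = const_bcontfun (c * d l) * ap_exp l" for l
      by (rule bcontfun_eqI) simp
    then have "const_bcontfun c * a = (\<Sum>l\<in>F. const_bcontfun (c * d l) * ap_exp l)"
      unfolding F(2) by (simp add: sum_distrib_left)
    then show ?thesis
      using F(1) by (auto intro!: trig_polys_sum trig_polys_term)
  qed
  with mult show ?thesis
    unfolding subalgebra_def by (auto intro: trig_polys_zero trig_polys_add)
qed

lemma subalgebra_closure:
  assumes "subalgebra A"
  shows "subalgebra (closure A)"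
proof -
  have lim: "l \<in> closure A" if "\<And>n. w n \<in> A" "w \<longlonglongrightarrow> l" for w l
    unfolding closure_sequential using that by blast
  have "a + b \<in> closure A \<and> a * b \<in> closure A" if ab: "a \<in> closure A" "b \<in> closure A" for a b
  proof -
    obtain u v where "\<And>n. u n \<in> A" "u \<longlonglongrightarrow> a" "\<And>n. v n \<in> A" "v \<longlonglongrightarrow> b"
      using ab unfolding closure_sequential by blast
    then show ?thesis
      using assms lim[of "\<lambda>n. u n + v n" "a + b"] lim[of "\<lambda>n. u n * v n" "a * b"]
      by (auto simp: subalgebra_def intro: tendsto_add tendsto_mult)
  qed
  moreover have "const_bcontfun c * a \<in> closure A" if a: "a \<in> closure A" for c a
  proof -
    obtain u where "\<And>n. u n \<in> A" "u \<longlonglongrightarrow> a"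
      using a unfolding closure_sequential by blast
    then show ?thesis
      using assms lim[of "\<lambda>n. const_bcontfun c * u n" "const_bcontfun c * a"]
      by (auto simp: subalgebra_def intro: tendsto_mult_left)
  qed
  moreover have "0 \<in> closure A"
    using assms closure_subset by (auto simp: subalgebra_def)
  ultimately show ?thesis
    by (auto simp: subalgebra_def)
qed

lemma subalgebra_sum:
  assumes "subalgebra A" "\<And>i. i \<in> I \<Longrightarrow> a i \<in> A"
  shows "(\<Sum>i\<in>I. a i) \<in> A"
  using assms(2)
  by (induction I rule: infinite_finite_induct) (use assms(1) in \<open>auto simp: subalgebra_def\<close>)

text \<open>Every closed subalgebra that contains all \<open>ap_exp l\<close> contains the trigonometric polynomials and
  hence their limits, which therefore lie in \<open>AP\<close>.\<close>
lemma AP_on_eq_closure: "AP_on S = closure (trig_polys S)"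
proof -
  have "trig_polys S \<subseteq> A" if "subalgebra A" "range ap_exp \<subseteq> A" for A
  proof
    fix a assume "a \<in> trig_polys S"
    then obtain F c where F: "a = (\<Sum>l\<in>F. const_bcontfun (c l) * ap_exp l)"
      by (auto simp: trig_polys_def)
    show "a \<in> A"
      unfolding F using that by (intro subalgebra_sum) (auto simp: subalgebra_def)
  qed
  then have "closure (trig_polys S) \<subseteq> AP"
    unfolding AP_def by (intro Inter_greatest closure_minimal) auto
  then show ?thesis
    by (auto simp: AP_on_def AP0_on_eq_trig_polys)
qed

section \<open>Exponentials in a closed subalgebra\<close>

lemma closed_subalgebra_suminf:
  assumes "subalgebra A" "closed A" "\<And>n::nat. s n \<in> A" "summable s"
  shows "suminf s \<in> A"
proof (rule closed_sequentially[OF assms(2)])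
  show "(\<Sum>i<n. s i) \<in> A" for n
    using assms(1,3) by (rule subalgebra_sum)
  show "(\<lambda>n. \<Sum>i<n. s i) \<longlonglongrightarrow> suminf s"
    using assms(4) by (rule summable_LIMSEQ)
qed

lemma subalgebra_scaleR: "subalgebra A \<Longrightarrow> a \<in> A \<Longrightarrow> r *\<^sub>R a \<in> A"
  by (metis const_bcontfun_of_real subalgebra_def)

lemma subalgebra_minus: "subalgebra A \<Longrightarrow> a \<in> A \<Longrightarrow> - a \<in> A"
  using subalgebra_scaleR[of A a "-1"] by simp

lemma subalgebra_power: "subalgebra A \<Longrightarrow> 1 \<in> A \<Longrightarrow> a \<in> A \<Longrightarrow> a ^ n \<in> A"
  by (induction n) (auto simp: subalgebra_def)

lemma closed_subalgebra_exp:
  assumes "subalgebra A" "closed A" "1 \<in> A" "g \<in> A"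
  shows "exp g \<in> A"
  unfolding exp_def using assms
  by (intro closed_subalgebra_suminf summable_exp_generic subalgebra_scaleR subalgebra_power)

lemma apply_power_bcontfun: "apply_bcontfun (h ^ n) x = apply_bcontfun h x ^ n"
  for h :: "real \<Rightarrow>\<^sub>C complex"
  by (induction n) auto

text \<open>The logarithm is the sum of the power series of \<open>log (1 + h)\<close>. That its exponential is \<open>1 + h\<close>
  is checked at each point, where the series is that of the principal branch.\<close>
lemma closed_subalgebra_log:
  assumes "subalgebra A" "closed A" "1 \<in> A" "h \<in> A" "norm h < 1"
  obtains k where "k \<in> A" "exp k = 1 + h"
proof
  let ?s = "\<lambda>n. ((-1) ^ Suc n / real n) *\<^sub>R h ^ n"
  \<comment> \<open>The term for \<open>n = 0\<close> vanishes because of division by zero.\<close>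
  have "summable (\<lambda>n. norm h ^ n)"
    using assms by (simp add: summable_geometric)
  moreover have "norm (?s n) \<le> norm h ^ n" for n
  proof -
    have "inverse (real n) \<le> 1"
      by (cases n) (auto simp: field_simps)
    from mult_right_mono[OF this norm_ge_zero[of "h ^ n"]] have "norm (?s n) \<le> norm (h ^ n)"
      by (simp add: divide_inverse abs_mult power_abs)
    also have "\<dots> \<le> norm h ^ n"
      by (rule norm_power_ineq)
    finally show ?thesis .
  qed
  ultimately have sum: "summable ?s"
    by (rule summable_comparison_test'[where N = 0])
  then show "suminf ?s \<in> A"
    using assms by (intro closed_subalgebra_suminf subalgebra_scaleR subalgebra_power)
  have "apply_bcontfun (suminf ?s) x = ln (1 + apply_bcontfun h x)" for x
  proof -
    have lin: "bounded_linear (\<lambda>f :: real \<Rightarrow>\<^sub>C complex. apply_bcontfun f x)"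
      by (rule bounded_linear_intro[where K = 1]) (auto simp: norm_bounded)
    have "cmod (apply_bcontfun h x) < 1"
      using norm_bounded[of h x] assms(5) by linarith
    then have "(\<lambda>n. (-1) ^ Suc n / of_nat n * apply_bcontfun h x ^ n) sums ln (1 + apply_bcontfun h x)"
      by (rule Ln_series)
    moreover have "apply_bcontfun (?s n) x = (-1) ^ Suc n / of_nat n * apply_bcontfun h x ^ n" for n
      by (simp only: scaleR_bcontfun.rep_eq apply_power_bcontfun) (simp add: scaleR_conv_of_real)
    ultimately have "(\<lambda>n. apply_bcontfun (?s n) x) sums ln (1 + apply_bcontfun h x)"
      by simp
    then show ?thesis
      using bounded_linear.sums[OF lin summable_sums[OF sum]] by (rule sums_unique2[symmetric])
  qed
  moreover have "1 + apply_bcontfun h x \<noteq> 0" for x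
    using norm_bounded[of h x] assms(5) by (auto simp: add_eq_0_iff)
  ultimately show "exp (suminf ?s) = 1 + h"
    by (intro bcontfun_eqI) (simp add: apply_exp_bcontfun)
qed

text \<open>Writing \<open>u = e\<^sup>g\<close>, the quotient \<open>v / u\<close> is \<open>1 + h\<close> with \<open>h = (v - u) e\<^sup>-\<^sup>g\<close> in the algebra. The lower bound
  of \<open>\<bar>u\<bar>\<close> gives \<open>\<parallel>h\<parallel> < 1\<close>, so \<open>1 + h\<close> has a logarithm there, to be added to \<open>g\<close>.\<close>
lemma exp_image_perturb:
  assumes A: "subalgebra A" "closed A" "1 \<in> A" and "u \<in> exp ` A" "v \<in> A" "0 < d"
    and lower: "\<And>x. d \<le> cmod (apply_bcontfun u x)" and "norm (v - u) < d"
  shows "v \<in> exp ` A"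
proof -
  obtain g where g: "g \<in> A" "u = exp g"
    using assms(4) by blast
  define h where "h = (v - u) * exp (- g)"
  have "u \<in> A" "exp (- g) \<in> A"
    using A g by (auto intro: closed_subalgebra_exp subalgebra_minus)
  moreover have "- u \<in> A"
    using A(1) \<open>u \<in> A\<close> by (rule subalgebra_minus)
  ultimately have "h \<in> A"
    using A(1) \<open>v \<in> A\<close> unfolding h_def subalgebra_def by (metis add_uminus_conv_diff)
  moreover have "norm h \<le> norm (v - u) / d"
  proof (rule norm_bound)
    fix x
    have "cmod (apply_bcontfun (v - u) x) / cmod (apply_bcontfun u x) \<le> norm (v - u) / d"
      using lower[of x] \<open>0 < d\<close> norm_bounded[of "v - u" x] by (intro frac_le) auto
    then show "norm (apply_bcontfun h x) \<le> norm (v - u) / d"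
      by (simp add: h_def g apply_exp_bcontfun exp_minus norm_mult norm_inverse divide_inverse)
  qed
  then have "norm h < 1"
    by (rule order.strict_trans1) (use assms in simp)
  ultimately obtain k where k: "k \<in> A" "exp k = 1 + h"
    using A closed_subalgebra_log by metis
  have "exp (apply_bcontfun k x) = 1 + apply_bcontfun h x" for x
    using arg_cong[OF k(2), of "\<lambda>f. apply_bcontfun f x"] by (simp add: apply_exp_bcontfun)
  then have "v = exp (g + k)"
    by (intro bcontfun_eqI) (simp add: apply_exp_bcontfun exp_add h_def g(2) exp_minus field_simps)
  moreover have "g + k \<in> A"
    using A(1) g k by (simp add: subalgebra_def)
  ultimately show ?thesis
    by blast
qed

text \<open>The radius \<open>d\<close> in \<open>exp_image_perturb\<close> is the same along the whole path. So two points
  of the path whose images lie in a common ball of radius \<open>d / 2\<close> are either both exponentials or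
  both not, and connectedness spreads the property over the whole path.\<close>
lemma exp_image_connected:
  assumes A: "subalgebra A" "closed A" "1 \<in> A" and "connected T" "continuous_on T P" "P ` T \<subseteq> A"
    and "0 < d" and lower: "\<And>t x. t \<in> T \<Longrightarrow> d \<le> cmod (apply_bcontfun (P t) x)"
    and "s \<in> T" "t \<in> T" "P s \<in> exp ` A"
  shows "P t \<in> exp ` A"
proof (rule connected_induction_simple[of T s t "\<lambda>t. P t \<in> exp ` A"])
  fix r assume "r \<in> T"
  define U where "U = T \<inter> P -` ball (P r) (d / 2)"
  have "openin (top_of_set T) U"
    unfolding U_def using assms(5) by (rule continuous_openin_preimage_gen) simp
  moreover have "r \<in> U"
    using \<open>r \<in> T\<close> \<open>0 < d\<close> by (simp add: U_def)
  moreover have "P y \<in> exp ` A" if "x \<in> U" "y \<in> U" "P x \<in> exp ` A" for x y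
  proof (rule exp_image_perturb[OF A that(3)])
    have "dist (P y) (P x) < d / 2 + d / 2"
      using that by (intro dist_triangle_less_add[of _ "P r"]) (auto simp: U_def dist_commute)
    then show "norm (P y - P x) < d"
      by (simp add: dist_norm)
  qed (use that assms in \<open>auto simp: U_def\<close>)
  ultimately show "\<exists>U. openin (top_of_set T) U \<and> r \<in> U \<and>
      (\<forall>x\<in>U. \<forall>y\<in>U. P x \<in> exp ` A \<longrightarrow> P y \<in> exp ` A)"
    by blast
qed (use assms in auto)

section \<open>Vertical translates of trigonometric polynomials\<close>

lemma norm_const_bcontfun: "norm (const_bcontfun c :: real \<Rightarrow>\<^sub>C complex) = cmod c"
  using norm_bounded[of "const_bcontfun c :: real \<Rightarrow>\<^sub>C complex" 0]
  by (intro antisym norm_bound) simp_all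

text \<open>The function \<open>x \<mapsto> p(x + it)\<close> for the polynomial \<open>p\<close> with coefficients \<open>c\<close>, as an element of
  the algebra.\<close>
definition vertical_translate :: "real set \<Rightarrow> (real \<Rightarrow> complex) \<Rightarrow> real \<Rightarrow> real \<Rightarrow>\<^sub>C complex"
  where "vertical_translate F c t =
    (\<Sum>l\<in>F. exp (- (l * t)) *\<^sub>R (const_bcontfun (c l) * ap_exp l))"

text \<open>As \<open>t \<rightarrow> \<infinity>\<close> the terms with positive frequency decay, so the translates tend in norm to the constant
  term \<open>c0\<close>. It inherits the lower bound, hence is nonzero and has a constant logarithm. Thus the
  translates for large \<open>t\<close> are exponentials, and then so are all those on the path over \<open>(0, \<infinity>)\<close>.\<close>
lemma vertical_translate_in_exp_image:
  assumes A: "subalgebra A" "closed A" "1 \<in> A" "ap_exp ` F \<subseteq> A" and "finite F" "F \<subseteq> {0..}"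
    and "0 < d" and lower: "\<And>t x. 0 < t \<Longrightarrow> d \<le> cmod (apply_bcontfun (vertical_translate F c t) x)"
    and "0 < t"
  shows "vertical_translate F c t \<in> exp ` A"
proof -
  define P where "P = vertical_translate F c"
  note lower = lower[folded P_def]
  note P_eq = vertical_translate_def[of F c, folded P_def, abs_def]
  define c0 where "c0 = (if 0 \<in> F then c 0 else 0)"
  have const: "const_bcontfun u \<in> A" for u
  proof -
    have "const_bcontfun u * 1 \<in> A"
      using A(1,3) unfolding subalgebra_def by blast
    then show ?thesis
      by simp
  qed
  have P_in: "P t \<in> A" for t
    unfolding P_eq using A by (intro subalgebra_sum subalgebra_scaleR) (auto simp: subalgebra_def)
  have "((\<lambda>t. exp (- (l * t)) *\<^sub>R (const_bcontfun (c l) * ap_exp l))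
      \<longlongrightarrow> (if l = 0 then const_bcontfun (c 0) else 0)) at_top" if l: "l \<in> F" for l
  proof (cases "l = 0")
    case True
    then show ?thesis
      by (simp add: ap_exp_zero)
  next
    case False
    then have "0 < l"
      using l \<open>F \<subseteq> {0..}\<close> by force
    then have "((\<lambda>t. exp (- (l * t))) \<longlongrightarrow> 0) at_top"
      by real_asymp
    then have "((\<lambda>t. exp (- (l * t)) *\<^sub>R (const_bcontfun (c l) * ap_exp l))
        \<longlongrightarrow> 0 *\<^sub>R (const_bcontfun (c l) * ap_exp l)) at_top"
      by (intro tendsto_scaleR tendsto_const)
    with False show ?thesis
      by simp
  qed
  then have "(P \<longlongrightarrow> (\<Sum>l\<in>F. if l = 0 then const_bcontfun (c 0) else 0)) at_top"
    unfolding P_eq by (intro tendsto_sum)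
  moreover have "const_bcontfun 0 = (0 :: real \<Rightarrow>\<^sub>C complex)"
    by (rule bcontfun_eqI) simp
  ultimately have lim: "(P \<longlongrightarrow> const_bcontfun c0) at_top"
    using \<open>finite F\<close> by (auto simp: c0_def split: if_splits)
  have c0: "d \<le> cmod c0"
  proof (rule tendsto_lowerbound)
    show "((\<lambda>t. norm (P t)) \<longlongrightarrow> cmod c0) at_top"
      using tendsto_norm[OF lim] by (simp add: norm_const_bcontfun)
    show "\<forall>\<^sub>F t in at_top. d \<le> norm (P t)"
      using eventually_gt_at_top[of 0]
      by eventually_elim (rule order_trans[OF lower norm_bounded[of _ 0]])
  qed simp
  have "\<forall>\<^sub>F t in at_top. 0 < t \<and> dist (P t) (const_bcontfun c0) < d"
    using eventually_gt_at_top[of 0] tendstoD[OF lim \<open>0 < d\<close>] by (rule eventually_conj)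
  then obtain s where s: "0 < s" "dist (P s) (const_bcontfun c0) < d"
    using eventually_happens'[OF trivial_limit_at_top_linorder] by blast
  have "c0 \<noteq> 0"
    using c0 \<open>0 < d\<close> by auto
  then have "const_bcontfun c0 = exp (const_bcontfun (ln c0) :: real \<Rightarrow>\<^sub>C complex)"
    by (intro bcontfun_eqI) (simp add: apply_exp_bcontfun)
  then have "const_bcontfun c0 \<in> exp ` A"
    using const by blast
  then have "P s \<in> exp ` A"
    by (rule exp_image_perturb[OF A(1-3) _ P_in \<open>0 < d\<close>]) (use c0 s in \<open>auto simp: dist_norm\<close>)
  moreover have "continuous_on {0<..} P"
    unfolding P_eq by (intro continuous_intros)
  ultimately show ?thesis
    unfolding P_def[symmetric] using P_in lower s(1) \<open>0 < t\<close> \<open>0 < d\<close>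
    by (intro exp_image_connected[OF A(1-3), of "{0<..}" P d s t]) auto
qed

lemma continuous_on_vertical_translate: "continuous_on S (vertical_translate F c)"
  unfolding vertical_translate_def[abs_def] by (intro continuous_intros)

lemma vertical_translate_zero: "vertical_translate F c 0 = (\<Sum>l\<in>F. const_bcontfun (c l) * ap_exp l)"
  by (simp add: vertical_translate_def)

lemma poisson_ext_trig_poly:
  assumes "F \<subseteq> {0..}" "0 < t"
  shows "poisson_ext (vertical_translate F c 0) (Complex x t) = apply_bcontfun (vertical_translate F c t) x"
proof -
  have "exp (\<i> * of_real l * Complex x t) = of_real (exp (- (l * t))) * exp (\<i> * of_real l * of_real x)" for l
  proof -
    have "\<i> * of_real l * Complex x t = of_real (- (l * t)) + \<i> * of_real l * of_real x"
      by (simp add: complex_eq_iff)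
    then show ?thesis
      by (simp only: exp_of_real[symmetric] exp_add[symmetric])
  qed
  moreover have "poisson_ext (const_bcontfun (c l) * ap_exp l) (Complex x t)
      = c l * exp (\<i> * of_real l * Complex x t)" if "l \<in> F" for l
    using assms that by (intro poisson_ext_ap_exp) auto
  ultimately have "poisson_ext (const_bcontfun (c l) * ap_exp l) (Complex x t)
      = apply_bcontfun (exp (- (l * t)) *\<^sub>R (const_bcontfun (c l) * ap_exp l)) x" if "l \<in> F" for l
    using that
    by (simp add: scaleR_bcontfun.rep_eq apply_ap_exp scaleR_conv_of_real[where 'a = complex])
  then show ?thesis
    using assms by (simp add: vertical_translate_zero poisson_ext_sum)
      (simp add: vertical_translate_def apply_sum_bcontfun)
qed

section \<open>Logarithms of functions bounded away from zero\<close>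

theorem theorem1p4:
  fixes \<Sigma> :: "real set" and f :: "real \<Rightarrow>\<^sub>C complex"
  assumes "\<Sigma> \<subseteq> {0..}"
    and "\<And>\<xi> \<mu>. \<xi> \<in> \<Sigma> \<Longrightarrow> \<mu> \<in> \<Sigma> \<Longrightarrow> \<xi> + \<mu> \<in> \<Sigma>"
    and "0 \<in> \<Sigma>"
    and "half_plane_dense (AP_on \<Sigma>)"
    and "f \<in> AP_on \<Sigma>"
    and "0 < (INF z\<in>upper_half_plane. cmod (poisson_ext f z))"
  shows "\<exists>g \<in> AP_on \<Sigma>. f = exp g"
proof -
  define A where "A = AP_on \<Sigma>"
  define \<delta> where "\<delta> = (INF z\<in>upper_half_plane. cmod (poisson_ext f z))"
  have A: "subalgebra A" "closed A" "ap_exp ` \<Sigma> \<subseteq> A"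
  proof -
    show "subalgebra A" "closed A"
      unfolding A_def AP_on_eq_closure
      using assms(2) by (auto intro: subalgebra_closure subalgebra_trig_polys)
    have "ap_exp l \<in> trig_polys \<Sigma>" if "l \<in> \<Sigma>" for l
      using trig_polys_term[OF that, of 1] by (simp flip: one_bcontfun_def)
    then show "ap_exp ` \<Sigma> \<subseteq> A"
      unfolding A_def AP_on_eq_closure using closure_subset by blast
  qed
  have one: "1 \<in> A"
    using A(3) assms(3) ap_exp_zero by force
  have "0 < \<delta>"
    using assms(6) by (simp add: \<delta>_def)
  have \<delta>_le: "\<delta> \<le> cmod (poisson_ext f z)" if "0 < Im z" for z
    unfolding \<delta>_def
    by (rule cINF_lower) (use that in \<open>auto simp: upper_half_plane_def intro!: bdd_belowI[of _ 0]\<close>)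
  \<comment> \<open>With an error of \<open>\<delta> / 4\<close> both for \<open>p\<close> and for a translate of \<open>p\<close>, the translate is within
    \<open>\<delta> / 2\<close> of \<open>f\<close>, less than its own lower bound \<open>3 \<delta> / 4\<close>.\<close>
  obtain p where p: "p \<in> trig_polys \<Sigma>" "dist p f < \<delta> / 4"
    using assms(5) \<open>0 < \<delta>\<close> unfolding AP_on_eq_closure closure_approachable
    by (metis zero_less_divide_iff zero_less_numeral)
  then obtain F c where F: "finite F" "F \<subseteq> \<Sigma>" "p = vertical_translate F c 0"
    by (auto simp: trig_polys_def vertical_translate_zero)
  have F_nonneg: "F \<subseteq> {0..}"
    using F(2) assms(1) by simp
  have lower: "3 * \<delta> / 4 \<le> cmod (apply_bcontfun (vertical_translate F c t) x)" if t: "0 < t" for t x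
  proof -
    let ?z = "Complex x t"
    have "\<delta> \<le> cmod (poisson_ext f ?z)"
      using t by (intro \<delta>_le) simp
    also have "poisson_ext f ?z = poisson_ext p ?z - poisson_ext (p - f) ?z"
      using t by (simp add: poisson_ext_diff)
    also have "cmod \<dots> \<le> cmod (poisson_ext p ?z) + norm (p - f)"
      using t norm_poisson_ext_le[of ?z "p - f"]
      by (intro order_trans[OF norm_triangle_ineq4]) simp
    finally show ?thesis
      using p(2) poisson_ext_trig_poly[OF F_nonneg t, of c x] F(3) by (simp add: dist_norm)
  qed
  \<comment> \<open>The Poisson integral represents the function only for \<open>Im z > 0\<close>, so the path ends at some small
    \<open>t > 0\<close>, and one last perturbation leads from there to \<open>f\<close>.\<close>
  have "(vertical_translate F c \<longlongrightarrow> p) (at_right 0)"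
    using continuous_on_vertical_translate[of UNIV F c] F(3)
    by (auto simp: continuous_on_def intro: tendsto_within_subset)
  then have "\<forall>\<^sub>F t in at_right 0. 0 < t \<and> dist (vertical_translate F c t) p < \<delta> / 4"
    using \<open>0 < \<delta>\<close> by (intro eventually_conj eventually_at_right_less tendstoD) simp_all
  then obtain t where t: "0 < t" "dist (vertical_translate F c t) p < \<delta> / 4"
    using eventually_happens'[OF trivial_limit_at_right_real] by blast
  have "vertical_translate F c t \<in> exp ` A"
    by (rule vertical_translate_in_exp_image[OF A(1,2) one _ F(1) F_nonneg _ lower t(1)])
      (use A(3) F(2) \<open>0 < \<delta>\<close> in auto)
  then have "f \<in> exp ` A"
  proof (rule exp_image_perturb[OF A(1,2) one])
    show "norm (f - vertical_translate F c t) < 3 * \<delta> / 4"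
      using dist_triangle[of f "vertical_translate F c t" p] p(2) t(2) \<open>0 < \<delta>\<close>
      by (simp add: dist_norm[symmetric] dist_commute)
  qed (use assms(5) A_def \<open>0 < \<delta>\<close> lower t(1) in auto)
  then show ?thesis
    by (auto simp: A_def)
qed

end
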